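(* Let $P$ be any probability distribution on $L_2[0,1]$, let $X_1,\dots,X_n,X_{n+1}$ be i.i.d. random functions with distribution $P$, and let $\alpha\in(0,1)$, $1\le n_1<n$, $p\ge1$, $K\ge1$. Let $[\tilde\ell_k(t),\tilde u_k(t)]$, $k=1,\dots,K$, $t\in[0,1]$, and $\tilde B_n(t)=\bigcup_{k=1}^K[\tilde\ell_k(t),\tilde u_k(t)]$ be the refined Gaussian-mixture conformal band defined in the context. Then $\tilde B_n$ is a union of $K$ bands, and $$\mathbb{P}\big\{\exists\,k\in\{1,\dots,K\}:\ (\Pi_pX_{n+1})(t)\in[\tilde\ell_k(t),\tilde u_k(t)]\ \text{ for all } t\in[0,1]\big\}\ \ge\ 1-\alpha .$$ (It is not assumed that $P$ is a Gaussian mixture.)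
   Context: $\langle f,g\rangle=\int_0^1 f(t)g(t)\,dt$; $a\wedge b=\min(a,b)$; $\varphi(\cdot;\mu,\Sigma)$ is the density on $\mathbb{R}^p$ of the normal distribution with mean $\mu$ and (positive definite) covariance $\Sigma$. $\mathbb{P}$ is the probability over $X_1,\dots,X_{n+1}$ and the random split. Construction. 1. Split the data at random (independently of the data values and of $X_{n+1}$) into parts of sizes $n_1$ and $n_2=n-n_1$; relabel so that the first part is $\mathbf X_1=\{X_1,\dots,X_{n_1}\}$ and the second is $\{X_{n_1+1},\dots,X_n\}$. 2. Let $\phi_1,\dots,\phi_p$ be the first $p$ (orthonormal) eigenfunctions of the empirical covariance function of $\mathbf X_1$, with fixed everywhere-defined representatives; they depend on $\mathbf X_1$ only. Write $\phi(t)=(\phi_1(t),\dots,\phi_p(t))^T$, $\xi_i=(\langle X_i,\phi_1\rangle,\dots,\langle X_i,\phi_p\rangle)\in\mathbb{R}^p$, and $(\Pi_pX)(t)=\sum_{j=1}^p\langle X,\phi_j\rangle\phi_j(t)$. 3. Let $\hat\pi_k>0$ (with $\sum_k\hat\pi_k=1$), $\hat\mu_k\in\mathbb{R}^p$, $\hat\Sigma_k$ positive definite, $k=1,\dots,K$, be estimates of mixture proportions, means and covariances (measurably) computed from $\mathbf X_1$ only, and let $\hat f(\xi)=\sum_{k=1}^K\hat\pi_k\varphi(\xi;\hat\mu_k,\hat\Sigma_k)$. 4. Sort the values $\hat f(\xi_i)$, $i=n_1+1,\dots,n$, as $f_1\le\dots\le f_{n_2}$ and let $\lambda=f_{\lceil(n_2+1)\alpha\rceil-1}$,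 with $f_0=-\infty$. 5. For $k\ne s$ let $\delta_{ks}=\sup_{\xi\in\mathbb{R}^p}\big(\hat\pi_k\varphi(\xi;\hat\mu_k,\hat\Sigma_k)\wedge\hat\pi_s\varphi(\xi;\hat\mu_s,\hat\Sigma_s)\big)$ and $\delta_k=\sum_{s\ne k}\delta_{ks}$. 6. Let $\tilde T_{n,k}=\{\xi\in\mathbb{R}^p:\varphi(\xi;\hat\mu_k,\hat\Sigma_k)\ge(\lambda-\delta_k)/\hat\pi_k\}$ and $$\tilde\ell_k(t)=\inf_{\xi\in\tilde T_{n,k}}\xi^T\phi(t),\qquad \tilde u_k(t)=\sup_{\xi\in\tilde T_{n,k}}\xi^T\phi(t),$$ as extended real numbers (so $[\tilde\ell_k(t),\tilde u_k(t)]$ is empty if $\tilde T_{n,k}=\emptyset$). *)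

theory Defs
  imports "HOL-Probability.Probability" "HOL-Combinatorics.Permutations"
begin

definition L2_fun :: "(real \<Rightarrow> real) set" where
  "L2_fun = {f \<in> borel_measurable (lebesgue_on {0..1}).
               integrable (lebesgue_on {0..1}) (\<lambda>t. (f t)\<^sup>2)}"

definition L2_inner :: "(real \<Rightarrow> real) \<Rightarrow> (real \<Rightarrow> real) \<Rightarrow> real" where
  "L2_inner f g = (\<integral>t. f t * g t \<partial>lebesgue_on {0..1})"

definition L2_dist :: "(real \<Rightarrow> real) \<Rightarrow> (real \<Rightarrow> real) \<Rightarrow> real" where
  "L2_dist f g = sqrt (L2_inner (\<lambda>t. f t - g t) (\<lambda>t. f t - g t))"

text \<open>
  The Borel space of \<open>L\<^sub>2[0,1]\<close>, carried by the square-integrable functions themselves rather than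
  by their classes modulo a.e. equality: it is generated by the sets that are open for the
  pseudometric \<^const>\<open>L2_dist\<close>.  These sets are saturated under a.e. equality, so measures on this
  space are the same as Borel measures on the quotient, and a measurable map into it is a random
  element of \<open>L\<^sub>2[0,1]\<close> together with a choice of everywhere-defined versions.
\<close>

definition L2_borel :: "(real \<Rightarrow> real) measure" where
  "L2_borel = sigma L2_fun
     {U. U \<subseteq> L2_fun \<and> (\<forall>f\<in>U. \<exists>e>0. \<forall>g\<in>L2_fun. L2_dist f g < e \<longrightarrow> g \<in> U)}"

definition empirical_mean :: "nat \<Rightarrow> (nat \<Rightarrow> real \<Rightarrow> real) \<Rightarrow> real \<Rightarrow> real" where
  "empirical_mean m x t = (\<Sum>i=1..m. x i t) / real m"

definition empirical_cov :: "nat \<Rightarrow> (nat \<Rightarrow> real \<Rightarrow> real) \<Rightarrow> real \<Rightarrow> real \<Rightarrow> real" where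
  "empirical_cov m x s t =
     (\<Sum>i=1..m. (x i s - empirical_mean m x s) * (x i t - empirical_mean m x t)) / real m"

definition is_eigenfunction :: "(real \<Rightarrow> real \<Rightarrow> real) \<Rightarrow> real \<Rightarrow> (real \<Rightarrow> real) \<Rightarrow> bool" where
  "is_eigenfunction C \<nu> f \<longleftrightarrow> f \<in> L2_fun \<and> L2_inner f f \<noteq> 0 \<and>
     (AE t in lebesgue_on {0..1}. (\<integral>s. C s t * f s \<partial>lebesgue_on {0..1}) = \<nu> * f t)"

text \<open>
  Orthonormal eigenfunctions, indexed by a finite linear order, whose eigenvalues are the largest
  ones in nonincreasing order and with multiplicity: no eigenfunction orthogonal to all of them has
  an eigenvalue exceeding any of theirs.  The eigenvalue 0 is allowed, so their number may exceed
  the rank of the kernel.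
\<close>

definition first_eigenfunctions ::
    "(real \<Rightarrow> real \<Rightarrow> real) \<Rightarrow> ('p::{finite,linorder} \<Rightarrow> real \<Rightarrow> real) \<Rightarrow> bool" where
  "first_eigenfunctions C \<phi> \<longleftrightarrow>
     (\<forall>i j. L2_inner (\<phi> i) (\<phi> j) = (if i = j then 1 else 0)) \<and>
     (\<exists>\<nu>. (\<forall>j. is_eigenfunction C (\<nu> j) (\<phi> j)) \<and>
          (\<forall>i j. i \<le> j \<longrightarrow> \<nu> j \<le> \<nu> i) \<and>
          (\<forall>\<kappa> \<psi>. is_eigenfunction C \<kappa> \<psi> \<and> (\<forall>j. L2_inner \<psi> (\<phi> j) = 0) \<longrightarrow> (\<forall>j. \<kappa> \<le> \<nu> j)))"

definition scores :: "('p::finite \<Rightarrow> real \<Rightarrow> real) \<Rightarrow> (real \<Rightarrow> real) \<Rightarrow> real ^ 'p" where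
  "scores \<phi> f = (\<chi> j. L2_inner f (\<phi> j))"

definition L2_proj :: "('p::finite \<Rightarrow> real \<Rightarrow> real) \<Rightarrow> (real \<Rightarrow> real) \<Rightarrow> real \<Rightarrow> real" where
  "L2_proj \<phi> f t = (\<Sum>j\<in>UNIV. L2_inner f (\<phi> j) * \<phi> j t)"

definition pos_definite :: "real ^ 'p ^ 'p::finite \<Rightarrow> bool" where
  "pos_definite S \<longleftrightarrow> transpose S = S \<and> (\<forall>v. v \<noteq> 0 \<longrightarrow> v \<bullet> (S *v v) > 0)"

definition mvn_density :: "real ^ 'p::finite \<Rightarrow> real ^ 'p ^ 'p \<Rightarrow> real ^ 'p \<Rightarrow> real" where
  "mvn_density \<mu> S \<xi> =
     exp (- ((\<xi> - \<mu>) \<bullet> (matrix_inv S *v (\<xi> - \<mu>))) / 2) / sqrt ((2 * pi) ^ CARD('p) * det S)"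

definition mixture_density ::
    "nat \<Rightarrow> (nat \<Rightarrow> real) \<Rightarrow> (nat \<Rightarrow> real ^ 'p::finite) \<Rightarrow> (nat \<Rightarrow> real ^ 'p ^ 'p) \<Rightarrow> real ^ 'p \<Rightarrow> real"
  where "mixture_density K w \<mu> S \<xi> = (\<Sum>k=1..K. w k * mvn_density (\<mu> k) (S k) \<xi>)"

definition overlap ::
    "(nat \<Rightarrow> real) \<Rightarrow> (nat \<Rightarrow> real ^ 'p::finite) \<Rightarrow> (nat \<Rightarrow> real ^ 'p ^ 'p) \<Rightarrow> nat \<Rightarrow> nat \<Rightarrow> real"
  where "overlap w \<mu> S k s =
    (SUP \<xi>. min (w k * mvn_density (\<mu> k) (S k) \<xi>) (w s * mvn_density (\<mu> s) (S s) \<xi>))"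

definition total_overlap ::
    "nat \<Rightarrow> (nat \<Rightarrow> real) \<Rightarrow> (nat \<Rightarrow> real ^ 'p::finite) \<Rightarrow> (nat \<Rightarrow> real ^ 'p ^ 'p) \<Rightarrow> nat \<Rightarrow> real"
  where "total_overlap K w \<mu> S k = (\<Sum>s\<in>{1..K} - {k}. overlap w \<mu> S k s)"

text \<open>The \<open>m\<close>-th smallest entry, counted from 1, with the convention that the 0-th is \<open>-\<infinity>\<close>.\<close>

definition order_stat :: "real list \<Rightarrow> nat \<Rightarrow> ereal" where
  "order_stat fs m = (if m = 0 then - \<infinity> else ereal (sort fs ! (m - 1)))"

text \<open>
  In the following \<open>z\<close> is the relabelled sample, indexed by \<open>{1..n}\<close>, with training part
  \<open>{1..n1}\<close>; \<open>\<phi>\<close>, \<open>w\<close>, \<open>\<mu>\<close>, \<open>S\<close> are the estimators (of the eigenfunctions, mixture proportions, means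
  and covariances), as functions of the training part alone.
\<close>

definition training :: "nat \<Rightarrow> (nat \<Rightarrow> real \<Rightarrow> real) \<Rightarrow> nat \<Rightarrow> real \<Rightarrow> real" where
  "training n1 z = restrict z {1..n1}"

definition threshold ::
    "real \<Rightarrow> nat \<Rightarrow> nat \<Rightarrow> nat
     \<Rightarrow> ((nat \<Rightarrow> real \<Rightarrow> real) \<Rightarrow> 'p::finite \<Rightarrow> real \<Rightarrow> real)
     \<Rightarrow> ((nat \<Rightarrow> real \<Rightarrow> real) \<Rightarrow> nat \<Rightarrow> real)
     \<Rightarrow> ((nat \<Rightarrow> real \<Rightarrow> real) \<Rightarrow> nat \<Rightarrow> real ^ 'p)
     \<Rightarrow> ((nat \<Rightarrow> real \<Rightarrow> real) \<Rightarrow> nat \<Rightarrow> real ^ 'p ^ 'p)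
     \<Rightarrow> (nat \<Rightarrow> real \<Rightarrow> real) \<Rightarrow> ereal"
  where "threshold \<alpha> n1 n K \<phi> w \<mu> S z =
    (let x = training n1 z
     in order_stat
          (map (\<lambda>i. mixture_density K (w x) (\<mu> x) (S x) (scores (\<phi> x) (z i))) [n1 + 1..<n + 1])
          (nat \<lceil>(real (n - n1) + 1) * \<alpha>\<rceil> - 1))"

definition level_region ::
    "real \<Rightarrow> nat \<Rightarrow> nat \<Rightarrow> nat
     \<Rightarrow> ((nat \<Rightarrow> real \<Rightarrow> real) \<Rightarrow> 'p::finite \<Rightarrow> real \<Rightarrow> real)
     \<Rightarrow> ((nat \<Rightarrow> real \<Rightarrow> real) \<Rightarrow> nat \<Rightarrow> real)
     \<Rightarrow> ((nat \<Rightarrow> real \<Rightarrow> real) \<Rightarrow> nat \<Rightarrow> real ^ 'p)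
     \<Rightarrow> ((nat \<Rightarrow> real \<Rightarrow> real) \<Rightarrow> nat \<Rightarrow> real ^ 'p ^ 'p)
     \<Rightarrow> (nat \<Rightarrow> real \<Rightarrow> real) \<Rightarrow> nat \<Rightarrow> (real ^ 'p) set"
  where "level_region \<alpha> n1 n K \<phi> w \<mu> S z k =
    (let x = training n1 z
     in {\<xi>. ereal (mvn_density (\<mu> x k) (S x k) \<xi>)
              \<ge> (threshold \<alpha> n1 n K \<phi> w \<mu> S z - ereal (total_overlap K (w x) (\<mu> x) (S x) k))
                  / ereal (w x k)})"

definition band_lower ::
    "real \<Rightarrow> nat \<Rightarrow> nat \<Rightarrow> nat
     \<Rightarrow> ((nat \<Rightarrow> real \<Rightarrow> real) \<Rightarrow> 'p::finite \<Rightarrow> real \<Rightarrow> real)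
     \<Rightarrow> ((nat \<Rightarrow> real \<Rightarrow> real) \<Rightarrow> nat \<Rightarrow> real)
     \<Rightarrow> ((nat \<Rightarrow> real \<Rightarrow> real) \<Rightarrow> nat \<Rightarrow> real ^ 'p)
     \<Rightarrow> ((nat \<Rightarrow> real \<Rightarrow> real) \<Rightarrow> nat \<Rightarrow> real ^ 'p ^ 'p)
     \<Rightarrow> (nat \<Rightarrow> real \<Rightarrow> real) \<Rightarrow> nat \<Rightarrow> real \<Rightarrow> ereal"
  where "band_lower \<alpha> n1 n K \<phi> w \<mu> S z k t =
    (INF \<xi>\<in>level_region \<alpha> n1 n K \<phi> w \<mu> S z k. ereal (\<xi> \<bullet> (\<chi> j. \<phi> (training n1 z) j t)))"

definition band_upper ::
    "real \<Rightarrow> nat \<Rightarrow> nat \<Rightarrow> nat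
     \<Rightarrow> ((nat \<Rightarrow> real \<Rightarrow> real) \<Rightarrow> 'p::finite \<Rightarrow> real \<Rightarrow> real)
     \<Rightarrow> ((nat \<Rightarrow> real \<Rightarrow> real) \<Rightarrow> nat \<Rightarrow> real)
     \<Rightarrow> ((nat \<Rightarrow> real \<Rightarrow> real) \<Rightarrow> nat \<Rightarrow> real ^ 'p)
     \<Rightarrow> ((nat \<Rightarrow> real \<Rightarrow> real) \<Rightarrow> nat \<Rightarrow> real ^ 'p ^ 'p)
     \<Rightarrow> (nat \<Rightarrow> real \<Rightarrow> real) \<Rightarrow> nat \<Rightarrow> real \<Rightarrow> ereal"
  where "band_upper \<alpha> n1 n K \<phi> w \<mu> S z k t =
    (SUP \<xi>\<in>level_region \<alpha> n1 n K \<phi> w \<mu> S z k. ereal (\<xi> \<bullet> (\<chi> j. \<phi> (training n1 z) j t)))"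

definition refined_band ::
    "real \<Rightarrow> nat \<Rightarrow> nat \<Rightarrow> nat
     \<Rightarrow> ((nat \<Rightarrow> real \<Rightarrow> real) \<Rightarrow> 'p::finite \<Rightarrow> real \<Rightarrow> real)
     \<Rightarrow> ((nat \<Rightarrow> real \<Rightarrow> real) \<Rightarrow> nat \<Rightarrow> real)
     \<Rightarrow> ((nat \<Rightarrow> real \<Rightarrow> real) \<Rightarrow> nat \<Rightarrow> real ^ 'p)
     \<Rightarrow> ((nat \<Rightarrow> real \<Rightarrow> real) \<Rightarrow> nat \<Rightarrow> real ^ 'p ^ 'p)
     \<Rightarrow> (nat \<Rightarrow> real \<Rightarrow> real) \<Rightarrow> real \<Rightarrow> ereal set"
  where "refined_band \<alpha> n1 n K \<phi> w \<mu> S z t =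
    (\<Union>k\<in>{1..K}. {band_lower \<alpha> n1 n K \<phi> w \<mu> S z k t .. band_upper \<alpha> n1 n K \<phi> w \<mu> S z k t})"

definition union_of_bands :: "nat \<Rightarrow> (real \<Rightarrow> ereal set) \<Rightarrow> bool" where
  "union_of_bands K B \<longleftrightarrow>
     (\<exists>l u. \<forall>t\<in>{0..1}. B t = (\<Union>k\<in>{1..K::nat}. {l k t .. u k t}))"

text \<open>
  The random split and the relabelling after it are encoded by one random permutation \<open>\<sigma>\<close> of
  \<open>{1..n}\<close>: the training part consists of the \<open>X (\<sigma> i)\<close> with \<open>i \<le> n1\<close>.
\<close>

definition relabel :: "(nat \<Rightarrow> 'a \<Rightarrow> real \<Rightarrow> real) \<Rightarrow> ('a \<Rightarrow> nat \<Rightarrow> nat) \<Rightarrow> 'a \<Rightarrow> nat \<Rightarrow> real \<Rightarrow> real"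
  where "relabel X \<sigma> \<omega> i = X (\<sigma> \<omega> i) \<omega>"

text \<open>
  The coverage event is an uncountable intersection over \<open>t\<close> involving arbitrary everywhere-defined
  versions of the eigenfunctions, hence need not be measurable.  Lower bounds on its probability are
  therefore expressed by the inner probability, which is the probability on measurable sets.
\<close>

definition inner_prob :: "'a measure \<Rightarrow> 'a set \<Rightarrow> real" where
  "inner_prob M A = (SUP E\<in>{E \<in> sets M. E \<subseteq> A}. measure M E)"

lemma (in prob_space) inner_prob_eq_prob:
  assumes "A \<in> events"
  shows "inner_prob M A = prob A"
  unfolding inner_prob_def
  by (rule cSup_eq_maximum) (use assms in \<open>auto intro: finite_measure_mono\<close>)

end

(* Let g be the estimated mixture density evaluated at the scores.  Conditionally on the split, the
   calibration curves and the new curve are exchangeable, so g(X_{n+1}) is at least the threshold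
   lambda with probability at least 1 - alpha; no property of P is used.  If k maximizes
   pi_k phi_k(xi), then every other component equals its minimum with component k and is at most
   delta_ks, so g(xi) >= lambda forces pi_k phi_k(xi) >= lambda - delta_k: the score lies in the k-th
   level region and the projected curve in the k-th band.  Measurability of the scores, which pair two
   random elements of L2[0,1], comes from separability of L2[0,1]. *)

theory Submission
  imports Defs
begin

section \<open>The pseudometric of square-integrable functions\<close>

text \<open>The coverage event may fail to be measurable, so its probability is never computed: the
  bound is proved for a measurable event inside it, stated purely by counting. With n2 calibration
  curves and m = ceil((n2 + 1) \<alpha>) - 1, the new score reaches the threshold iff at least m
  calibration scores do not exceed it. Counting makes ties harmless, so the scores may have atoms.
  It also reduces exchangeability to combinatorics: of n2 + 1 numbers, at most m have fewer than m
  others that do not exceed them. The level is then read off from m \<le> (n2 + 1) \<alpha>. The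
  real obstacle is that the score must be measurable jointly in the training sample and the curve.
  Curves are functions and not classes, so only a pseudometric is available, and its basic
  inequalities are derived by hand. Polarization reduces inner products to distances; for the
  density, Cramer's rule replaces the inverse covariance by quotients of determinants.\<close>

abbreviation unit_interval_measure :: "real measure" where
  "unit_interval_measure \<equiv> lebesgue_on {0..1}"

lemma L2_fun_measurable [measurable_dest]: "f \<in> L2_fun \<Longrightarrow> f \<in> borel_measurable unit_interval_measure"
  by (simp add: L2_fun_def)

lemma finite_measure_unit_interval: "finite_measure unit_interval_measure"
  by (auto intro!: finite_measureI simp: emeasure_restrict_space)

lemma L2_fun_integrable_mult:
  assumes "f \<in> L2_fun" "g \<in> L2_fun"
  shows "integrable unit_interval_measure (\<lambda>t. f t * g t)"
proof (rule Bochner_Integration.integrable_bound)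
  show "integrable unit_interval_measure (\<lambda>t. (f t)\<^sup>2 + (g t)\<^sup>2)"
    using assms by (auto simp: L2_fun_def)
  show "(\<lambda>t. f t * g t) \<in> borel_measurable unit_interval_measure"
    using assms by measurable
  have "\<bar>a * b\<bar> \<le> a\<^sup>2 + b\<^sup>2" for a b :: real
  proof -
    have "0 \<le> (\<bar>a\<bar> - \<bar>b\<bar>)\<^sup>2" "0 \<le> a\<^sup>2 + b\<^sup>2" by auto
    then show ?thesis
      unfolding power2_diff abs_mult power2_abs by linarith
  qed
  then show "AE t in unit_interval_measure. norm (f t * g t) \<le> norm ((f t)\<^sup>2 + (g t)\<^sup>2)"
    by simp
qed

lemma L2_fun_bounded:
  assumes "f \<in> borel_measurable unit_interval_measure" "\<And>t. t \<in> {0..1} \<Longrightarrow> \<bar>f t\<bar> \<le> B"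
  shows "f \<in> L2_fun"
proof -
  have "integrable unit_interval_measure (\<lambda>t. (f t)\<^sup>2)"
  proof (rule finite_measure.integrable_const_bound[OF finite_measure_unit_interval])
    show "AE t in unit_interval_measure. norm ((f t)\<^sup>2) \<le> B\<^sup>2"
      using assms(2) by (intro AE_I2) (force simp flip: abs_le_square_iff)
    show "(\<lambda>t. (f t)\<^sup>2) \<in> borel_measurable unit_interval_measure"
      using assms(1) by measurable
  qed
  with assms(1) show ?thesis by (simp add: L2_fun_def)
qed

lemma L2_fun_zero: "(\<lambda>_. 0) \<in> L2_fun"
  by (simp add: L2_fun_def)

lemma L2_fun_add_scale:
  assumes "f \<in> L2_fun" "g \<in> L2_fun"
  shows "(\<lambda>t. f t + s * g t) \<in> L2_fun"
proof -
  have "integrable unit_interval_measure (\<lambda>t. f t * f t + 2 * s * (f t * g t) + s\<^sup>2 * (g t * g t))"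
    by (intro Bochner_Integration.integrable_add integrable_mult_right L2_fun_integrable_mult assms)
  moreover have "(\<lambda>t. f t + s * g t) \<in> borel_measurable unit_interval_measure"
    using assms by measurable
  ultimately show ?thesis
    by (simp add: L2_fun_def power2_eq_square algebra_simps)
qed

lemma L2_fun_diff: "f \<in> L2_fun \<Longrightarrow> g \<in> L2_fun \<Longrightarrow> (\<lambda>t. f t - g t) \<in> L2_fun"
  using L2_fun_add_scale[of f g "-1"] by simp

text \<open>One quadratic in \<open>s\<close> serves three purposes: s = -1 gives polarization, s =
  1 the triangle inequality, and a free \<open>s\<close> Cauchy-Schwarz.\<close>

lemma L2_inner_add_scale:
  assumes "f \<in> L2_fun" "g \<in> L2_fun"
  shows "L2_inner (\<lambda>t. f t + s * g t) (\<lambda>t. f t + s * g t)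
    = L2_inner f f + 2 * s * L2_inner f g + s\<^sup>2 * L2_inner g g"
proof -
  have "L2_inner (\<lambda>t. f t + s * g t) (\<lambda>t. f t + s * g t) =
      (\<integral>t. f t * f t + 2 * s * (f t * g t) + s\<^sup>2 * (g t * g t) \<partial>unit_interval_measure)"
    unfolding L2_inner_def by (simp add: power2_eq_square algebra_simps)
  also have "\<dots> = L2_inner f f + 2 * s * L2_inner f g + s\<^sup>2 * L2_inner g g"
    unfolding L2_inner_def by (simp add: L2_fun_integrable_mult assms)
  finally show ?thesis .
qed

lemma L2_inner_self_nonneg: "0 \<le> L2_inner f f"
  unfolding L2_inner_def by (simp add: integral_nonneg_AE)

lemma L2_inner_polarization:
  assumes "f \<in> L2_fun" "g \<in> L2_fun"
  shows "L2_inner f g = ((L2_dist f (\<lambda>_. 0))\<^sup>2 + (L2_dist g (\<lambda>_. 0))\<^sup>2 - (L2_dist f g)\<^sup>2) / 2"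
proof -
  have *: "(L2_dist u v)\<^sup>2 = L2_inner (\<lambda>t. u t - v t) (\<lambda>t. u t - v t)" for u v
    by (simp add: L2_dist_def L2_inner_self_nonneg)
  show ?thesis
    unfolding * using L2_inner_add_scale[OF assms, of "-1"] by simp
qed

lemma L2_cauchy_schwarz:
  assumes "f \<in> L2_fun" "g \<in> L2_fun"
  shows "(L2_inner f g)\<^sup>2 \<le> L2_inner f f * L2_inner g g"
proof -
  let ?a = "L2_inner f f" and ?b = "L2_inner f g" and ?c = "L2_inner g g"
  have *: "0 \<le> ?a + 2 * s * ?b + s\<^sup>2 * ?c" for s
    using L2_inner_add_scale[OF assms, of s] L2_inner_self_nonneg by metis
  show ?thesis
  proof (cases "?c = 0")
    case True
    have "?b = 0"
    proof (rule ccontr)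
      assume "?b \<noteq> 0"
      \<comment> \<open>With \<open>?c = 0\<close> the quadratic degenerates to an affine function
        of \<open>s\<close>, and this \<open>s\<close> makes it -1. The case cannot be dismissed by
        g = 0, since \<open>g\<close> vanishes only almost everywhere.\<close>
      then have "2 * (- (?a + 1) / (2 * ?b)) * ?b = - ?a - 1" by (simp add: field_simps)
      with *[of "- (?a + 1) / (2 * ?b)"] True show False by simp
    qed
    with True show ?thesis by simp
  next
    case False
    then have "0 < ?c" using L2_inner_self_nonneg[of g] by linarith
    \<comment> \<open>The value - ?b / ?c is the minimizer of the quadratic in
      \<open>s\<close>.\<close>
    have "0 \<le> (?a + 2 * (- ?b / ?c) * ?b + (- ?b / ?c)\<^sup>2 * ?c) * ?c"
      using *[of "- ?b / ?c"] \<open>0 < ?c\<close> by simp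
    also have "\<dots> = ?a * ?c - ?b\<^sup>2"
      using False by (simp add: field_simps power2_eq_square)
    finally show ?thesis by simp
  qed
qed

lemma L2_dist_triangle:
  assumes "f \<in> L2_fun" "g \<in> L2_fun" "h \<in> L2_fun"
  shows "L2_dist f h \<le> L2_dist f g + L2_dist g h"
proof -
  define u v where "u = (\<lambda>t. f t - g t)" and "v = (\<lambda>t. g t - h t)"
  have uv: "u \<in> L2_fun" "v \<in> L2_fun"
    using assms by (auto simp: u_def v_def L2_fun_diff)
  have "L2_inner u v \<le> sqrt (L2_inner u u) * sqrt (L2_inner v v)"
    using real_sqrt_le_mono[OF L2_cauchy_schwarz[OF uv]] by (simp add: real_sqrt_mult)
  then have "L2_inner (\<lambda>t. u t + 1 * v t) (\<lambda>t. u t + 1 * v t)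
      \<le> (sqrt (L2_inner u u) + sqrt (L2_inner v v))\<^sup>2"
    using L2_inner_add_scale[OF uv, of 1] by (simp add: power2_sum L2_inner_self_nonneg)
  then have "sqrt (L2_inner (\<lambda>t. u t + 1 * v t) (\<lambda>t. u t + 1 * v t))
      \<le> sqrt (L2_inner u u) + sqrt (L2_inner v v)"
    by (intro real_le_lsqrt) (auto simp: L2_inner_self_nonneg)
  then show ?thesis by (simp add: L2_dist_def u_def v_def)
qed

lemma L2_dist_commute: "L2_dist f g = L2_dist g f"
  by (simp add: L2_dist_def L2_inner_def algebra_simps)

lemma L2_dist_le_sup:
  assumes "f \<in> L2_fun" "g \<in> L2_fun" "\<And>t. t \<in> {0..1} \<Longrightarrow> \<bar>f t - g t\<bar> \<le> e"
  shows "L2_dist f g \<le> e"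
proof -
  have "0 \<le> e" using assms(3)[of 0] by auto
  have "L2_inner (\<lambda>t. f t - g t) (\<lambda>t. f t - g t) \<le> (\<integral>t. e\<^sup>2 \<partial>unit_interval_measure)"
    unfolding L2_inner_def
  proof (rule integral_mono)
    show "integrable unit_interval_measure (\<lambda>t. (f t - g t) * (f t - g t))"
      by (intro L2_fun_integrable_mult L2_fun_diff assms)
    show "integrable unit_interval_measure (\<lambda>t. e\<^sup>2)"
      using finite_measure.integrable_const[OF finite_measure_unit_interval] .
    fix t :: real assume "t \<in> space unit_interval_measure"
    then show "(f t - g t) * (f t - g t) \<le> e\<^sup>2"
      using assms(3)[of t] \<open>0 \<le> e\<close> by (simp flip: power2_eq_square add: abs_le_square_iff[symmetric])
  qed
  also have "\<dots> = e\<^sup>2"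
    by (simp add: measure_restrict_space)
  finally show ?thesis
    using \<open>0 \<le> e\<close> by (simp add: L2_dist_def real_le_lsqrt)
qed

text \<open>Dominated convergence for the squared difference, with majorant
  \<open>h t * h t\<close>. Both limits in the density proof below, truncation and continuous
  approximation, have this form.\<close>

lemma L2_dist_tendsto_0:
  assumes "\<And>m. g m \<in> L2_fun" "f \<in> L2_fun" "h \<in> L2_fun"
    and "AE t in unit_interval_measure. (\<lambda>m. g m t) \<longlonglongrightarrow> f t"
    and "\<And>m t. t \<in> {0..1} \<Longrightarrow> \<bar>g m t - f t\<bar> \<le> \<bar>h t\<bar>"
  shows "(\<lambda>m. L2_dist (g m) f) \<longlonglongrightarrow> 0"
proof -
  have "(\<lambda>m. \<integral>t. (g m t - f t) * (g m t - f t) \<partial>unit_interval_measure)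
      \<longlonglongrightarrow> (\<integral>t. 0 \<partial>unit_interval_measure)"
  proof (rule integral_dominated_convergence)
    show "integrable unit_interval_measure (\<lambda>t. h t * h t)"
      by (intro L2_fun_integrable_mult assms)
    show "(\<lambda>t. (g m t - f t) * (g m t - f t)) \<in> borel_measurable unit_interval_measure" for m
      using assms(1)[of m] assms(2) by measurable
    show "AE t in unit_interval_measure. (\<lambda>m. (g m t - f t) * (g m t - f t)) \<longlonglongrightarrow> 0"
      using assms(4)
    proof eventually_elim
      case (elim t)
      then have "(\<lambda>m. g m t - f t) \<longlonglongrightarrow> 0"
        using LIM_zero by blast
      then show ?case using tendsto_mult[of _ 0 _ _ 0] by fastforce
    qed
    show "AE t in unit_interval_measure. norm ((g m t - f t) * (g m t - f t)) \<le> h t * h t" for m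
      using assms(5) by (auto intro!: AE_I2 simp: abs_le_square_iff simp flip: power2_eq_square)
  qed simp
  then show ?thesis
    unfolding L2_dist_def L2_inner_def using tendsto_real_sqrt by fastforce
qed

section \<open>Separability and measurability of the inner product\<close>

text \<open>The dense family is indexed by \<open>rat list\<close> because that type is countable.
  The length of the list fixes the degree; by truncated subtraction the empty list yields a constant
  function.\<close>

definition rational_bernstein :: "rat list \<Rightarrow> real \<Rightarrow> real" where
  "rational_bernstein q x = (\<Sum>k\<le>length q - 1. of_rat (q ! k) * Bernstein (length q - 1) k x)"

lemma continuous_on_rational_bernstein: "continuous_on A (rational_bernstein q)"
  unfolding rational_bernstein_def Bernstein_def by (intro continuous_intros)

lemma L2_fun_continuous:
  assumes "continuous_on {0..1} f"
  shows "f \<in> L2_fun"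
proof -
  have "compact (f ` {0..1})"
    using assms by (intro compact_continuous_image) auto
  then obtain B where "\<forall>y\<in>f ` {0..1}. norm y \<le> B"
    using compact_imp_bounded bounded_iff by metis
  moreover have "f \<in> borel_measurable unit_interval_measure"
    using assms by (intro continuous_imp_measurable_on_sets_lebesgue) auto
  ultimately show ?thesis
    by (intro L2_fun_bounded[of f B]) auto
qed

text \<open>Round the coefficients of a Bernstein approximation to rationals. On the unit interval
  the Bernstein polynomials are nonnegative with sum 1, so rounding each coefficient by less than e
  / 2 costs at most e / 2.\<close>

lemma rational_bernstein_uniformly_dense:
  assumes "continuous_on {0..1} f" "0 < e"
  obtains q where "\<And>x. x \<in> {0..1} \<Longrightarrow> \<bar>f x - rational_bernstein q x\<bar> < e"
proof -
  obtain n where n: "\<And>x. x \<in> {0..1} \<Longrightarrow> \<bar>f x - (\<Sum>k\<le>n. f (k / n) * Bernstein n k x)\<bar> < e / 2"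
    using Bernstein_Weierstrass[OF assms(1), of "e / 2"] assms(2) by auto
  have "\<exists>r. \<bar>f (real k / n) - of_rat r\<bar> < e / 2" for k
  proof -
    obtain r where "f (real k / n) - e / 2 < of_rat r" "of_rat r < f (real k / n) + e / 2"
      using of_rat_dense[of "f (real k / n) - e / 2" "f (real k / n) + e / 2"] assms(2) by auto
    then have "\<bar>f (real k / n) - of_rat r\<bar> < e / 2" by linarith
    then show ?thesis ..
  qed
  then obtain r where r: "\<And>k. \<bar>f (real k / n) - of_rat (r k)\<bar> < e / 2"
    by metis
  define q where "q = map r [0..<Suc n]"
  have q: "length q - 1 = n" "\<And>k. k \<le> n \<Longrightarrow> q ! k = r k"
    by (auto simp: q_def simp del: upt_Suc)
  have "\<bar>f x - rational_bernstein q x\<bar> < e" if x: "x \<in> {0..1}" for x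
  proof -
    have "\<bar>(\<Sum>k\<le>n. f (k / n) * Bernstein n k x) - rational_bernstein q x\<bar>
        = \<bar>\<Sum>k\<le>n. (f (k / n) - of_rat (r k)) * Bernstein n k x\<bar>"
      unfolding rational_bernstein_def q(1) by (simp add: q(2) sum_subtractf algebra_simps)
    also have "\<dots> \<le> (\<Sum>k\<le>n. \<bar>(f (k / n) - of_rat (r k)) * Bernstein n k x\<bar>)"
      by (rule sum_abs)
    also have "\<dots> \<le> (\<Sum>k\<le>n. e / 2 * Bernstein n k x)"
      unfolding abs_mult using x less_imp_le[OF r]
      by (intro sum_mono mult_mono) (auto simp: Bernstein_nonneg assms(2) less_imp_le)
    also have "\<dots> = e / 2"
      unfolding sum_distrib_left[symmetric] by simp
    finally show ?thesis using n[OF x] by linarith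
  qed
  then show ?thesis using that by blast
qed

lemma L2_fun_clamp:
  assumes "f \<in> borel_measurable unit_interval_measure" "0 \<le> b"
  shows "(\<lambda>t. max (- b) (min b (f t))) \<in> L2_fun"
  using assms by (intro L2_fun_bounded[of _ b]) auto

text \<open>Three errors, each at most e / 3: truncate \<open>f\<close> at a level \<open>m\<close>,
  replace the truncation by a continuous function, and replace that one by a rational Bernstein
  polynomial.\<close>

lemma rational_bernstein_L2_dense:
  assumes "f \<in> L2_fun" "0 < e"
  obtains q where "L2_dist f (rational_bernstein q) < e"
proof -
  define c where "c m t = max (- real m) (min (real m) (f t))" for m t
  have cL: "c m \<in> L2_fun" for m
    unfolding c_def using assms(1) by (intro L2_fun_clamp L2_fun_measurable) auto
  have "(\<lambda>m. L2_dist (c m) f) \<longlonglongrightarrow> 0"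
  proof (rule L2_dist_tendsto_0[OF cL assms(1,1)])
    have "(\<lambda>m. c m t) \<longlonglongrightarrow> f t" for t
    proof (rule tendsto_eventually)
      obtain m0 :: nat where "\<bar>f t\<bar> \<le> real m0" using real_arch_simple by blast
      then show "\<forall>\<^sub>F m in sequentially. c m t = f t"
        by (intro eventually_sequentiallyI[of m0]) (auto simp: c_def)
    qed
    then show "AE t in unit_interval_measure. (\<lambda>m. c m t) \<longlonglongrightarrow> f t" by simp
    show "\<bar>c m t - f t\<bar> \<le> \<bar>f t\<bar>" for m t
      by (auto simp: c_def)
  qed
  then have "\<forall>\<^sub>F m in sequentially. L2_dist (c m) f < e / 3"
    using assms(2) by (intro order_tendstoD(2)) auto
  then obtain m where m: "L2_dist (c m) f < e / 3"
    using eventually_sequentially by auto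
  \<comment> \<open>This notion of measurability is by definition a limit of continuous functions
    off a negligible set, which supplies the approximants \<open>g i\<close>.\<close>
  have "f measurable_on {0..1}"
    using assms(1) by (simp add: measurable_on_iff_borel_measurable L2_fun_measurable)
  then obtain N g where N: "negligible N" and g: "\<And>i. continuous_on UNIV (g i)"
    "\<And>t. t \<notin> N \<Longrightarrow> (\<lambda>i. g i t) \<longlonglongrightarrow> (if t \<in> {0..1} then f t else 0)"
    unfolding measurable_on_def by metis
  \<comment> \<open>The \<open>g i\<close> converge without any common bound. Clamping them at the
    level already used for \<open>f\<close> keeps them continuous, makes them converge to
    \<open>c m\<close>, and provides the constant majorant 2 m.\<close>
  define G where "G i t = max (- real m) (min (real m) (g i t))" for i t
  have Gc: "continuous_on {0..1} (G i)" for i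
    unfolding G_def using g(1)[of i] by (intro continuous_intros) (auto intro: continuous_on_subset)
  have "(\<lambda>i. L2_dist (G i) (c m)) \<longlonglongrightarrow> 0"
  proof (rule L2_dist_tendsto_0[OF L2_fun_continuous[OF Gc] cL])
    show "(\<lambda>_. 2 * real m) \<in> L2_fun" by (intro L2_fun_continuous continuous_intros)
    have "AE t in lebesgue. t \<notin> N"
      using N by (simp add: AE_not_in negligible_iff_null_sets)
    then have "AE t in lebesgue. t \<in> {0..1} \<longrightarrow> (\<lambda>i. G i t) \<longlonglongrightarrow> c m t"
    proof eventually_elim
      case (elim t)
      then show ?case
        using g(2)[of t] unfolding G_def c_def by (auto intro!: tendsto_intros)
    qed
    then show "AE t in unit_interval_measure. (\<lambda>i. G i t) \<longlonglongrightarrow> c m t"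
      by (simp add: AE_restrict_space_iff)
    show "\<bar>G i t - c m t\<bar> \<le> \<bar>2 * real m\<bar>" for i t
      by (auto simp: G_def c_def)
  qed
  then have "\<forall>\<^sub>F i in sequentially. L2_dist (G i) (c m) < e / 3"
    using assms(2) by (intro order_tendstoD(2)) auto
  then obtain i where i: "L2_dist (G i) (c m) < e / 3"
    using eventually_sequentially by auto
  obtain q where q: "\<And>x. x \<in> {0..1} \<Longrightarrow> \<bar>G i x - rational_bernstein q x\<bar> < e / 3"
    using rational_bernstein_uniformly_dense[OF Gc, of "e / 3"] assms(2) by auto
  have qL: "rational_bernstein q \<in> L2_fun"
    by (intro L2_fun_continuous continuous_on_rational_bernstein)
  have "L2_dist (G i) (rational_bernstein q) \<le> e / 3"
    using q by (intro L2_dist_le_sup L2_fun_continuous Gc continuous_on_rational_bernstein)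
      (auto intro: less_imp_le)
  moreover have "L2_dist f (rational_bernstein q)
      \<le> L2_dist f (c m) + (L2_dist (c m) (G i) + L2_dist (G i) (rational_bernstein q))"
    using L2_dist_triangle[OF assms(1) cL[of m] qL]
      L2_dist_triangle[OF cL[of m] L2_fun_continuous[OF Gc[of i]] qL] by linarith
  ultimately show ?thesis
    using m i that[of q] by (simp add: L2_dist_commute)
qed

section \<open>Measurability of distance and inner product on the space of curves\<close>

lemma space_L2_borel [simp]: "space L2_borel = L2_fun"
  unfolding L2_borel_def by (rule space_measure_of) blast

text \<open>By the triangle inequality a ball around \<open>d\<close> is open for the pseudometric,
  hence one of the generating sets.\<close>

lemma L2_dist_measurable_left:
  assumes "d \<in> L2_fun"
  shows "(\<lambda>f. L2_dist f d) \<in> borel_measurable L2_borel"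
  unfolding borel_measurable_iff_less
proof
  fix a
  have "{f \<in> L2_fun. L2_dist f d < a} \<in> sets L2_borel"
    unfolding L2_borel_def
  proof (rule in_measure_of)
    have "\<exists>e>0. \<forall>g\<in>L2_fun. L2_dist f g < e \<longrightarrow> L2_dist g d < a"
      if "f \<in> L2_fun" "L2_dist f d < a" for f
    proof (intro exI[of _ "a - L2_dist f d"] conjI ballI impI)
      fix g assume "g \<in> L2_fun" "L2_dist f g < a - L2_dist f d"
      then show "L2_dist g d < a"
        using L2_dist_triangle[of g f d] assms that(1) L2_dist_commute[of f g] by linarith
    qed (use that in simp)
    then show "{f \<in> L2_fun. L2_dist f d < a} \<in> {U. U \<subseteq> L2_fun \<and>
        (\<forall>f\<in>U. \<exists>e>0. \<forall>g\<in>L2_fun. L2_dist f g < e \<longrightarrow> g \<in> U)}"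
      by fastforce
  qed blast
  then show "{f \<in> space L2_borel. L2_dist f d < a} \<in> sets L2_borel" by simp
qed

text \<open>Joint measurability rests on separability: it reduces the distance to distances from a
  countable dense family.\<close>

lemma L2_dist_less_iff:
  assumes "f \<in> L2_fun" "g \<in> L2_fun"
  shows "L2_dist f g < a \<longleftrightarrow>
    (\<exists>q. L2_dist f (rational_bernstein q) + L2_dist g (rational_bernstein q) < a)"
proof -
  have B: "rational_bernstein q \<in> L2_fun" for q
    by (intro L2_fun_continuous continuous_on_rational_bernstein)
  show ?thesis
  proof
    assume "L2_dist f g < a"
    then obtain q where q: "L2_dist f (rational_bernstein q) < (a - L2_dist f g) / 2"
      using rational_bernstein_L2_dense[OF assms(1), of "(a - L2_dist f g) / 2"] by auto
    moreover have "L2_dist g (rational_bernstein q) \<le> L2_dist f g + L2_dist f (rational_bernstein q)"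
      using L2_dist_triangle[OF assms(2,1) B] by (simp add: L2_dist_commute)
    ultimately have "L2_dist f (rational_bernstein q) + L2_dist g (rational_bernstein q) < a"
      by (simp add: field_simps)
    then show "\<exists>q. L2_dist f (rational_bernstein q) + L2_dist g (rational_bernstein q) < a" ..
  next
    assume "\<exists>q. L2_dist f (rational_bernstein q) + L2_dist g (rational_bernstein q) < a"
    then obtain q where "L2_dist f (rational_bernstein q) + L2_dist g (rational_bernstein q) < a" ..
    then show "L2_dist f g < a"
      using L2_dist_triangle[OF assms(1) B assms(2), of q]
      by (simp add: L2_dist_commute[of "rational_bernstein q"])
  qed
qed

lemma measurable_L2_dist:
  assumes f: "f \<in> M \<rightarrow>\<^sub>M L2_borel" and g: "g \<in> M \<rightarrow>\<^sub>M L2_borel"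
  shows "(\<lambda>x. L2_dist (f x) (g x)) \<in> borel_measurable M"
  unfolding borel_measurable_iff_less
proof
  fix a
  have B: "rational_bernstein q \<in> L2_fun" for q
    by (intro L2_fun_continuous continuous_on_rational_bernstein)
  note [measurable] = measurable_compose[OF f L2_dist_measurable_left[OF B]]
    measurable_compose[OF g L2_dist_measurable_left[OF B]]
  \<comment> \<open>Since \<open>rat list\<close> is countable, the existential is a countable union
    of sets that involve only distances to fixed functions.\<close>
  have "{x \<in> space M. L2_dist (f x) (g x) < a} = {x \<in> space M.
      \<exists>q. L2_dist (f x) (rational_bernstein q) + L2_dist (g x) (rational_bernstein q) < a}"
    using measurable_space[OF f] measurable_space[OF g] by (auto simp: L2_dist_less_iff)
  also have "\<dots> \<in> sets M" by measurable
  finally show "{x \<in> space M. L2_dist (f x) (g x) < a} \<in> sets M" .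
qed

lemma measurable_L2_inner:
  assumes f: "f \<in> M \<rightarrow>\<^sub>M L2_borel" and g: "g \<in> M \<rightarrow>\<^sub>M L2_borel"
  shows "(\<lambda>x. L2_inner (f x) (g x)) \<in> borel_measurable M"
proof -
  have "(\<lambda>_. \<lambda>_. 0) \<in> M \<rightarrow>\<^sub>M L2_borel"
    by (simp add: L2_fun_zero)
  note [measurable] = measurable_L2_dist[OF f this] measurable_L2_dist[OF g this]
    measurable_L2_dist[OF f g]
  have "(\<lambda>x. ((L2_dist (f x) (\<lambda>_. 0))\<^sup>2 + (L2_dist (g x) (\<lambda>_. 0))\<^sup>2 - (L2_dist (f x) (g x))\<^sup>2) / 2)
      \<in> borel_measurable M"
    by measurable
  then show ?thesis
    using measurable_space[OF f] measurable_space[OF g]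
    by (subst measurable_cong[OF L2_inner_polarization]) auto
qed

section \<open>Conformal coverage under exchangeability\<close>

text \<open>In a sorted list the entries not exceeding \<open>c\<close> form an initial segment,
  whose length decides which positions belong to it.\<close>

lemma sorted_nth_le_iff:
  fixes xs :: "'a::linorder list"
  assumes "sorted xs" "j < length xs"
  shows "xs ! j \<le> c \<longleftrightarrow> j < length (filter (\<lambda>y. y \<le> c) xs)"
  using assms
proof (induction xs arbitrary: j)
  case (Cons a xs)
  have "filter (\<lambda>y. y \<le> c) xs = []" if "\<not> a \<le> c"
    using that Cons.prems(1) by (auto simp: filter_empty_conv)
  moreover have "\<not> xs ! i \<le> c" if "\<not> a \<le> c" "i < length xs" for i
    using that Cons.prems(1) by (auto simp: all_set_conv_all_nth)
  ultimately show ?case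
    using Cons by (auto simp: nth_Cons split: nat.split)
qed simp

text \<open>Replaces sorting by counting, which is visibly invariant under permutations of the
  sample. For \<open>m = 0\<close> both sides hold, the left one by the convention that the 0-th
  entry is minus infinity.\<close>

lemma order_stat_le_iff:
  assumes "m \<le> length fs"
  shows "order_stat fs m \<le> ereal c \<longleftrightarrow> m \<le> length (filter (\<lambda>y. y \<le> c) fs)"
proof (cases m)
  case (Suc j)
  then have "sort fs ! j \<le> c \<longleftrightarrow> j < length (filter (\<lambda>y. y \<le> c) (sort fs))"
    using assms by (intro sorted_nth_le_iff) auto
  then show ?thesis
    using Suc by (simp add: order_stat_def filter_sort Suc_le_eq)
qed (simp add: order_stat_def)

text \<open>Take an index \<open>j\<close> of largest value among those of low rank. All the others
  of low rank have values at most \<open>v j\<close>, so they are among the fewer than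
  \<open>m\<close> indices counted for \<open>j\<close>; adding \<open>j\<close> itself gives at
  most \<open>m\<close>, with or without ties.\<close>

lemma card_low_rank_le:
  fixes v :: "'i \<Rightarrow> real"
  assumes "finite J"
  shows "card {j \<in> J. card {i \<in> J - {j}. v i \<le> v j} < m} \<le> m"
proof (cases "{j \<in> J. card {i \<in> J - {j}. v i \<le> v j} < m} = {}")
  case False
  define L where "L = {j \<in> J. card {i \<in> J - {j}. v i \<le> v j} < m}"
  have "finite L" "L \<noteq> {}"
    using assms False by (auto simp: L_def)
  then obtain j where j: "j \<in> L" "\<And>i. i \<in> L \<Longrightarrow> v i \<le> v j"
    using Max_in[of "v ` L"] Max_ge[of "v ` L"] by fastforce
  have "L \<subseteq> insert j {i \<in> J - {j}. v i \<le> v j}"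
    using j by (auto simp: L_def)
  then have "card L \<le> card (insert j {i \<in> J - {j}. v i \<le> v j})"
    using assms by (intro card_mono) auto
  also have "\<dots> \<le> Suc (card {i \<in> J - {j}. v i \<le> v j})"
    by (rule card_insert_le_m1) auto
  also have "\<dots> \<le> m"
    using j(1) by (simp add: L_def Suc_le_eq)
  finally show ?thesis by (simp add: L_def)
qed (metis card.empty zero_le)

lemma measurable_card_Collect:
  fixes R :: "'i \<Rightarrow> 'a \<Rightarrow> bool"
  assumes "finite F" "\<And>i. i \<in> F \<Longrightarrow> Measurable.pred M (R i)"
  shows "Measurable.pred M (\<lambda>z. m \<le> card {i \<in> F. R i z})"
proof -
  have "card {i \<in> F. R i z} = (\<Sum>i\<in>F. if R i z then 1 else 0)" for z
    using assms(1) by (simp add: sum.If_cases Collect_conj_eq)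
  moreover have "(\<lambda>z. \<Sum>i\<in>F. if R i z then 1 else 0 :: nat) \<in> M \<rightarrow>\<^sub>M count_space UNIV"
    using assms(2) by measurable
  ultimately show ?thesis by simp
qed

text \<open>Swapping the test index with any index of \<open>J\<close> preserves the product measure and the training
  coordinates, so the coverage probability is an average over \<open>J\<close> of events of which at most
  \<open>m\<close> fail at any sample point.\<close>

lemma conformal_coverage:
  fixes P :: "'b measure" and g :: "('i \<Rightarrow> 'b) \<Rightarrow> 'b \<Rightarrow> real" and m :: nat
  assumes P: "prob_space P" and I: "finite I" "J \<subseteq> I" "l \<in> J"
    and g: "(\<lambda>(x, y). g x y) \<in> borel_measurable (Pi\<^sub>M (I - J) (\<lambda>_. P) \<Otimes>\<^sub>M P)"
  defines "Q \<equiv> Pi\<^sub>M I (\<lambda>_. P)"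
  defines "A \<equiv> \<lambda>j. {z \<in> space Q. m \<le> card {i \<in> J - {j}.
      g (restrict z (I - J)) (z i) \<le> g (restrict z (I - J)) (z j)}}"
  shows "A l \<in> sets Q" and "real (card J) - real m \<le> real (card J) * measure Q (A l)"
proof -
  interpret Q: prob_space Q
    unfolding Q_def by (intro prob_space_PiM P)
  have J: "finite J" using I finite_subset by blast
  have score: "(\<lambda>z. g (restrict z (I - J)) (z i)) \<in> borel_measurable Q" if "i \<in> J" for i
  proof -
    have "(\<lambda>z. (restrict z (I - J), z i)) \<in> Q \<rightarrow>\<^sub>M Pi\<^sub>M (I - J) (\<lambda>_. P) \<Otimes>\<^sub>M P"
      unfolding Q_def using that I
      by (intro measurable_Pair measurable_restrict_subset measurable_component_singleton) auto
    from measurable_compose[OF this g] show ?thesis by simp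
  qed
  have A: "A j \<in> sets Q" if "j \<in> J" for j
  proof -
    have "Measurable.pred Q (\<lambda>z. m \<le> card {i \<in> J - {j}.
        g (restrict z (I - J)) (z i) \<le> g (restrict z (I - J)) (z j)})"
    proof (rule measurable_card_Collect)
      show "finite (J - {j})" using J by simp
      fix i assume "i \<in> J - {j}"
      then have "i \<in> J" by simp
      then show "Measurable.pred Q (\<lambda>z. g (restrict z (I - J)) (z i) \<le> g (restrict z (I - J)) (z j))"
        unfolding pred_def using score that by (intro borel_measurable_le)
    qed
    then show ?thesis by (simp add: A_def pred_def)
  qed
  show "A l \<in> sets Q" using A I by simp
  have same: "measure Q (A j) = measure Q (A l)" if j: "j \<in> J" for j
  proof -
    define s where "s = Transposition.transpose l j"
    have s: "s i = i" if "i \<notin> J" for i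
      using j I that by (auto simp: s_def Transposition.transpose_def)
    have s_in: "s i \<in> J" if "i \<in> J" for i
      using j I that by (auto simp: s_def Transposition.transpose_def)
    have s_inv: "s (s i) = i" for i by (simp add: s_def)
    have s_I: "s i \<in> I" if "i \<in> I" for i
      using j I that by (auto simp: s_def Transposition.transpose_def)
    have s_l: "s l = j" "s j = l" by (simp_all add: s_def)
    define T where "T z = (\<lambda>i\<in>I. z (s i))" for z :: "'i \<Rightarrow> 'b"
    have "distr (Pi\<^sub>M I (\<lambda>_. P)) (Pi\<^sub>M I (\<lambda>_. P)) (\<lambda>z. \<lambda>i\<in>I. z (s i)) = Pi\<^sub>M I (\<lambda>_. P)"
      using P s_I by (intro distr_PiM_reindex) (auto simp: s_def)
    then have dist: "distr Q Q T = Q"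
      by (simp add: Q_def T_def[abs_def])
    have T: "T \<in> Q \<rightarrow>\<^sub>M Q"
      unfolding T_def[abs_def] Q_def
      by (intro measurable_restrict measurable_component_singleton s_I)
    have "T -` A l \<inter> space Q = A j"
    proof -
      have "T z \<in> A l \<longleftrightarrow> z \<in> A j" if z: "z \<in> space Q" for z
      proof -
        have r: "restrict (T z) (I - J) = restrict z (I - J)"
          using s by (auto simp: T_def)
        have Tz: "T z i = z (s i)" if "i \<in> J" for i
          using that I by (auto simp: T_def)
        define h where "h = g (restrict z (I - J))"
        \<comment> \<open>The swap fixes the training coordinates, so \<open>h\<close> is the same
          before and after it, and it carries the indices counted for \<open>j\<close> bijectively
          onto those counted for \<open>l\<close>.\<close>
        have "{i \<in> J - {l}. h (T z i) \<le> h (T z l)} = s ` {i \<in> J - {j}. h (z i) \<le> h (z j)}"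
          (is "?L = ?R")
        proof (intro set_eqI iffI)
          fix i assume "i \<in> ?L"
          then have "s i \<in> {i \<in> J - {j}. h (z i) \<le> h (z j)}"
            using I s_in s_l s_inv Tz by (auto, metis s_inv s_l(2))
          then show "i \<in> ?R" using s_inv[of i] by (metis imageI)
        next
          fix i assume "i \<in> ?R"
          then obtain i' where "i = s i'" "i' \<in> J" "i' \<noteq> j" "h (z i') \<le> h (z j)" by auto
          moreover from this have "i \<noteq> l" using s_l(1) s_inv by metis
          ultimately show "i \<in> ?L"
            using I s_in s_l s_inv Tz by simp
        qed
        moreover have "inj s" by (simp add: s_def)
        ultimately have "card {i \<in> J - {l}. h (T z i) \<le> h (T z l)}
            = card {i \<in> J - {j}. h (z i) \<le> h (z j)}"
          by (simp add: card_image inj_on_subset)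
        then show ?thesis
          using measurable_space[OF T z] z r by (simp add: A_def h_def)
      qed
      moreover have "A j \<subseteq> space Q" by (auto simp: A_def)
      ultimately show ?thesis by auto
    qed
    moreover have "measure Q (A l) = measure (distr Q Q T) (A l)"
      by (simp add: dist)
    moreover have "\<dots> = measure Q (T -` A l \<inter> space Q)"
      using A I T by (intro measure_distr) auto
    ultimately show ?thesis by simp
  qed
  have pointwise: "real (card J) - real m \<le> (\<Sum>j\<in>J. indicator (A j) z)" if z: "z \<in> space Q" for z
  proof -
    have "{j \<in> J. z \<notin> A j} = {j \<in> J. card {i \<in> J - {j}.
        g (restrict z (I - J)) (z i) \<le> g (restrict z (I - J)) (z j)} < m}"
      using z by (auto simp: A_def not_le)
    then have "card {j \<in> J. z \<notin> A j} \<le> m"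
      using card_low_rank_le[OF J, of "\<lambda>i. g (restrict z (I - J)) (z i)" m] by simp
    moreover have "card J = card {j \<in> J. z \<in> A j} + card {j \<in> J. z \<notin> A j}"
      using J by (subst card_Un_disjoint[symmetric]) (auto intro: arg_cong[where f = card])
    moreover have "(\<Sum>j\<in>J. indicator (A j) z) = real (card {j \<in> J. z \<in> A j})"
      using J by (simp add: indicator_def sum.If_cases Collect_conj_eq)
    ultimately show ?thesis by linarith
  qed
  have int: "integrable Q (indicator (A j) :: _ \<Rightarrow> real)" if "j \<in> J" for j
    using A that by (simp add: Q.emeasure_eq_measure)
  have "real (card J) - real m = (\<integral>z. real (card J) - real m \<partial>Q)"
    by (simp add: Q.prob_space)
  also have "\<dots> \<le> (\<integral>z. (\<Sum>j\<in>J. indicator (A j) z) \<partial>Q)"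
    using int pointwise by (intro integral_mono) auto
  also have "\<dots> = (\<Sum>j\<in>J. measure Q (A j))"
    using int A by (simp add: Bochner_Integration.integral_sum)
  also have "\<dots> = real (card J) * measure Q (A l)"
    using same by simp
  finally show "real (card J) - real m \<le> real (card J) * measure Q (A l)" .
qed

section \<open>Gaussian mixture densities\<close>

text \<open>A vector in the kernel makes the quadratic form vanish, so the kernel is
  trivial.\<close>

lemma pos_definite_det_nz:
  assumes "pos_definite S"
  shows "det S \<noteq> 0"
proof -
  have "x = 0" if "S *v x = 0" for x
    using assms that unfolding pos_definite_def by (metis inner_zero_right less_irrefl)
  then show ?thesis
    using matrix_left_invertible_ker[of S] invertible_left_inverse[of S] invertible_det_nz[of S] by blast
qed

lemma matrix_inv_mult_right:
  assumes "invertible S"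
  shows "S ** matrix_inv S = mat 1"
  using someI_ex[OF assms[unfolded invertible_def]] by (simp add: matrix_inv_def)

lemma pos_definite_mult_inv:
  assumes "pos_definite S"
  shows "S *v (matrix_inv S *v v) = v"
  using matrix_inv_mult_right[of S] pos_definite_det_nz[OF assms]
  by (simp add: invertible_det_nz matrix_vector_mul_assoc)

text \<open>Substituting v = S u turns the form of the inverse into the form of \<open>S\<close> at
  u.\<close>

lemma pos_definite_inv_nonneg:
  assumes "pos_definite S"
  shows "0 \<le> v \<bullet> (matrix_inv S *v v)"
proof -
  define u where "u = matrix_inv S *v v"
  have "0 \<le> u \<bullet> (S *v u)"
    using assms by (cases "u = 0") (auto simp: pos_definite_def less_imp_le)
  then show ?thesis
    using pos_definite_mult_inv[OF assms, of v] by (simp add: u_def inner_commute)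
qed

text \<open>The exponent is nonpositive, so the exponential is at most 1. The absolute value in the
  bound avoids determining the sign of \<open>det S\<close>.\<close>

lemma mvn_density_bounded:
  assumes "pos_definite S"
  obtains B where "\<And>\<xi>. mvn_density \<mu> S \<xi> \<le> B"
proof
  fix \<xi>
  define c where "c = sqrt ((2 * pi) ^ CARD('a) * det S)"
  have "mvn_density \<mu> S \<xi> = exp (- ((\<xi> - \<mu>) \<bullet> (matrix_inv S *v (\<xi> - \<mu>))) / 2) / c"
    by (simp add: mvn_density_def c_def)
  also have "\<dots> \<le> \<bar>exp (- ((\<xi> - \<mu>) \<bullet> (matrix_inv S *v (\<xi> - \<mu>))) / 2) / c\<bar>"
    by (rule abs_ge_self)
  also have "\<dots> \<le> 1 / \<bar>c\<bar>"
    using pos_definite_inv_nonneg[OF assms, of "\<xi> - \<mu>"] by (auto intro: divide_right_mono)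
  finally show "mvn_density \<mu> S \<xi> \<le> 1 / \<bar>sqrt ((2 * pi) ^ CARD('a) * det S)\<bar>"
    by (simp add: c_def)
qed

text \<open>A real supremum dominates its members only if the set is bounded above; here a bound on
  component \<open>k\<close> alone suffices, because the minimum lies below it.\<close>

lemma min_le_overlap:
  assumes "pos_definite (S k)" "0 \<le> w k"
  shows "min (w k * mvn_density (\<mu> k) (S k) \<xi>) (w s * mvn_density (\<mu> s) (S s) \<xi>) \<le> overlap w \<mu> S k s"
  unfolding overlap_def
proof (rule cSUP_upper)
  obtain B where "\<And>\<xi>. mvn_density (\<mu> k) (S k) \<xi> \<le> B"
    using mvn_density_bounded[OF assms(1)] by blast
  then show "bdd_above (range (\<lambda>\<xi>. min (w k * mvn_density (\<mu> k) (S k) \<xi>)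
      (w s * mvn_density (\<mu> s) (S s) \<xi>)))"
    using assms(2) by (intro bdd_aboveI[of _ "w k * B"]) (auto intro!: min.coboundedI1 mult_left_mono)
qed simp

text \<open>The index obtained depends on \<open>\<xi>\<close>, which is why coverage is by some
  band and not by one fixed in advance. The overlap is a supremum over all points, so the correction
  itself does not depend on \<open>\<xi>\<close>.\<close>

lemma mixture_density_le_component:
  assumes "1 \<le> K" "\<And>k. k \<in> {1..K} \<Longrightarrow> pos_definite (S k)" "\<And>k. k \<in> {1..K} \<Longrightarrow> 0 \<le> w k"
  obtains k where "k \<in> {1..K}"
    "mixture_density K w \<mu> S \<xi> \<le> w k * mvn_density (\<mu> k) (S k) \<xi> + total_overlap K w \<mu> S k"
proof -
  define h where "h k = w k * mvn_density (\<mu> k) (S k) \<xi>" for k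
  have "Max (h ` {1..K}) \<in> h ` {1..K}"
    using assms(1) by (intro Max_in) auto
  then obtain k where k: "k \<in> {1..K}" "\<And>s. s \<in> {1..K} \<Longrightarrow> h s \<le> h k"
    by (metis (mono_tags, lifting) Max_ge finite_atLeastAtMost finite_imageI imageE imageI)
  have "mixture_density K w \<mu> S \<xi> = h k + (\<Sum>s\<in>{1..K} - {k}. h s)"
    unfolding mixture_density_def h_def[symmetric] using k(1) by (simp add: sum.remove)
  also have "(\<Sum>s\<in>{1..K} - {k}. h s) \<le> total_overlap K w \<mu> S k"
    unfolding total_overlap_def
  proof (rule sum_mono)
    fix s assume "s \<in> {1..K} - {k}"
    then show "h s \<le> overlap w \<mu> S k s"
      using min_le_overlap[of S k w \<mu> \<xi> s] assms(2,3) k by (simp add: h_def)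
  qed
  finally show ?thesis
    by (intro that[OF k(1)]) (simp add: h_def)
qed

section \<open>Measurability of Gaussian densities in all their arguments\<close>

lemma borel_measurable_vec_nth:
  fixes f :: "'a \<Rightarrow> 'b::topological_space ^ 'n"
  assumes "f \<in> borel_measurable M"
  shows "(\<lambda>x. f x $ i) \<in> borel_measurable M"
  using assms by (rule measurable_compose)
    (intro borel_measurable_continuous_onI continuous_on_component continuous_on_id)

lemma borel_measurable_det:
  fixes A :: "'a \<Rightarrow> real ^ 'n ^ 'n"
  assumes "\<And>i j. (\<lambda>x. A x $ i $ j) \<in> borel_measurable M"
  shows "(\<lambda>x. det (A x)) \<in> borel_measurable M"
  unfolding det_def using assms by measurable

text \<open>\<open>matrix_inv\<close> is defined by a choice operator and reveals nothing about
  measurability. Cramer's rule expresses the vector it produces through determinants, which are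
  polynomials in the entries.\<close>

lemma borel_measurable_mvn_density:
  fixes \<mu> \<xi> :: "'a \<Rightarrow> real ^ 'p" and S :: "'a \<Rightarrow> real ^ 'p ^ 'p"
  assumes \<mu>: "\<mu> \<in> borel_measurable M" and S: "S \<in> borel_measurable M"
    and \<xi>: "\<And>j. (\<lambda>x. \<xi> x $ j) \<in> borel_measurable M"
    and pd: "\<And>x. x \<in> space M \<Longrightarrow> pos_definite (S x)"
  shows "(\<lambda>x. mvn_density (\<mu> x) (S x) (\<xi> x)) \<in> borel_measurable M"
proof -
  note [measurable] = \<xi> borel_measurable_vec_nth[OF \<mu>]
    borel_measurable_vec_nth[OF borel_measurable_vec_nth[OF S]]
  define b where "b x = \<xi> x - \<mu> x" for x
  have [measurable]: "(\<lambda>x. b x $ i) \<in> borel_measurable M" for i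
    by (simp add: b_def)
  \<comment> \<open>Cramer's numerator: column \<open>k\<close> of the covariance is replaced by the
    centred score.\<close>
  define D where "D k x = det (\<chi> i j. if j = k then b x $ i else S x $ i $ j)" for k x
  have [measurable]: "D k \<in> borel_measurable M" for k
    unfolding D_def by (rule borel_measurable_det) simp
  have [measurable]: "(\<lambda>x. det (S x)) \<in> borel_measurable M"
    by (rule borel_measurable_det) measurable
  have "mvn_density (\<mu> x) (S x) (\<xi> x) =
      exp (- (\<Sum>k\<in>UNIV. b x $ k * (D k x / det (S x))) / 2) / sqrt ((2 * pi) ^ CARD('p) * det (S x))"
    if "x \<in> space M" for x
  proof -
    have "matrix_inv (S x) *v b x = (\<chi> k. D k x / det (S x))"
      using cramer[OF pos_definite_det_nz[OF pd[OF that]], of "matrix_inv (S x) *v b x" "b x"]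
        pos_definite_mult_inv[OF pd[OF that]] by (simp add: D_def)
    then show ?thesis
      by (simp add: mvn_density_def inner_vec_def flip: b_def)
  qed
  moreover have "(\<lambda>x. exp (- (\<Sum>k\<in>UNIV. b x $ k * (D k x / det (S x))) / 2)
      / sqrt ((2 * pi) ^ CARD('p) * det (S x))) \<in> borel_measurable M"
    by measurable
  ultimately show ?thesis
    by (simp cong: measurable_cong)
qed

section \<open>The refined band\<close>

lemma L2_proj_eq_inner: "L2_proj \<phi> f t = scores \<phi> f \<bullet> (\<chi> j. \<phi> j t)"
  by (simp add: L2_proj_def scores_def inner_vec_def)

text \<open>Identifies the threshold condition with the rank event of
  \<open>conformal_coverage\<close>. As \<alpha> < 1, the index is at most n - n1, so the order
  statistic stays inside the list.\<close>

lemma threshold_le_iff: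
  fixes \<phi> :: "(nat \<Rightarrow> real \<Rightarrow> real) \<Rightarrow> 'p::finite \<Rightarrow> real \<Rightarrow> real"
    and w :: "_ \<Rightarrow> nat \<Rightarrow> real" and \<mu> :: "_ \<Rightarrow> nat \<Rightarrow> real ^ 'p" and S :: "_ \<Rightarrow> nat \<Rightarrow> real ^ 'p ^ 'p"
    and K :: nat
  assumes "\<alpha> < 1" "n1 \<le> n"
  defines "g \<equiv> \<lambda>x f. mixture_density K (w x) (\<mu> x) (S x) (scores (\<phi> x) f)"
  shows "threshold \<alpha> n1 n K \<phi> w \<mu> S z \<le> ereal c \<longleftrightarrow>
    nat \<lceil>(real (n - n1) + 1) * \<alpha>\<rceil> - 1 \<le> card {i \<in> {n1 + 1..n}. g (training n1 z) (z i) \<le> c}"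
proof -
  have "(real (n - n1) + 1) * \<alpha> \<le> real (n - n1) + 1"
    using assms(1) by (intro mult_left_le) auto
  then have "nat \<lceil>(real (n - n1) + 1) * \<alpha>\<rceil> - 1 \<le> n - n1"
    by linarith
  moreover have "length (filter (\<lambda>y. y \<le> c) (map (\<lambda>i. g (training n1 z) (z i)) [n1 + 1..<n + 1]))
      = card {i \<in> {n1 + 1..n}. g (training n1 z) (z i) \<le> c}"
    by (auto simp: filter_map o_def distinct_length_filter simp del: upt_Suc intro: arg_cong[where f = card])
  ultimately show ?thesis
    using assms(2) by (simp add: threshold_def Let_def g_def order_stat_le_iff del: upt_Suc)
qed

text \<open>This part is deterministic. The level region does not depend on \<open>t\<close>, so
  membership of the single score vector puts the whole projected curve between the infimum and the
  supremum, with one \<open>k\<close> for all \<open>t\<close>.\<close>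

lemma covered_if_threshold_le:
  fixes \<phi> :: "(nat \<Rightarrow> real \<Rightarrow> real) \<Rightarrow> 'p::finite \<Rightarrow> real \<Rightarrow> real"
    and n1 :: nat and z :: "nat \<Rightarrow> real \<Rightarrow> real"
  defines "x \<equiv> training n1 z"
  assumes "1 \<le> K" "\<And>k. k \<in> {1..K} \<Longrightarrow> pos_definite (S x k)" "\<And>k. k \<in> {1..K} \<Longrightarrow> 0 < w x k"
    and thr: "threshold \<alpha> n1 n K \<phi> w \<mu> S z
      \<le> ereal (mixture_density K (w x) (\<mu> x) (S x) (scores (\<phi> x) f))"
  obtains k where "k \<in> {1..K}" "\<And>t. ereal (L2_proj (\<phi> x) f t)
      \<in> {band_lower \<alpha> n1 n K \<phi> w \<mu> S z k t .. band_upper \<alpha> n1 n K \<phi> w \<mu> S z k t}"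
proof -
  let ?\<xi> = "scores (\<phi> x) f"
  obtain k where k: "k \<in> {1..K}"
    "mixture_density K (w x) (\<mu> x) (S x) ?\<xi>
      \<le> w x k * mvn_density (\<mu> x k) (S x k) ?\<xi> + total_overlap K (w x) (\<mu> x) (S x) k"
    using mixture_density_le_component[of K "S x" "w x" "\<mu> x" ?\<xi>] assms(2-4) less_imp_le by metis
  \<comment> \<open>The case split concerns the extended reals: minus infinity makes the claim
    trivial, and plus infinity contradicts \<open>thr\<close>.\<close>
  have "threshold \<alpha> n1 n K \<phi> w \<mu> S z - ereal (total_overlap K (w x) (\<mu> x) (S x) k)
      \<le> ereal (w x k) * ereal (mvn_density (\<mu> x k) (S x k) ?\<xi>)"
    using thr k(2) by (cases "threshold \<alpha> n1 n K \<phi> w \<mu> S z") auto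
  then have "?\<xi> \<in> level_region \<alpha> n1 n K \<phi> w \<mu> S z k"
    using assms(4)[OF k(1)]
    by (simp add: level_region_def Let_def ereal_divide_le_pos flip: x_def)
  then have "ereal (L2_proj (\<phi> x) f t)
      \<in> {band_lower \<alpha> n1 n K \<phi> w \<mu> S z k t .. band_upper \<alpha> n1 n K \<phi> w \<mu> S z k t}" for t
    unfolding band_lower_def band_upper_def L2_proj_eq_inner x_def[symmetric]
    by (auto intro: INF_lower SUP_upper)
  with k(1) show ?thesis using that by blast
qed

lemma measurable_mixture_score:
  fixes \<phi> :: "'x \<Rightarrow> 'p::finite \<Rightarrow> real \<Rightarrow> real"
  assumes \<phi>: "\<And>j. (\<lambda>x. \<phi> x j) \<in> N \<rightarrow>\<^sub>M L2_borel"
    and w: "\<And>k. k \<in> {1..K} \<Longrightarrow> (\<lambda>x. w x k) \<in> borel_measurable N"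
    and \<mu>: "\<And>k. k \<in> {1..K} \<Longrightarrow> (\<lambda>x. \<mu> x k) \<in> borel_measurable N"
    and S: "\<And>k. k \<in> {1..K} \<Longrightarrow> (\<lambda>x. S x k) \<in> borel_measurable N"
    and pd: "\<And>x k. x \<in> space N \<Longrightarrow> k \<in> {1..K} \<Longrightarrow> pos_definite (S x k)"
  shows "(\<lambda>(x, f). mixture_density K (w x) (\<mu> x) (S x) (scores (\<phi> x) f))
    \<in> borel_measurable (N \<Otimes>\<^sub>M L2_borel)"
proof -
  have "(\<lambda>p. scores (\<phi> (fst p)) (snd p) $ j) \<in> borel_measurable (N \<Otimes>\<^sub>M L2_borel)" for j
    unfolding scores_def
    by (simp add: measurable_L2_inner[OF measurable_snd measurable_compose[OF measurable_fst \<phi>]])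
  then have "(\<lambda>p. mvn_density (\<mu> (fst p) k) (S (fst p) k) (scores (\<phi> (fst p)) (snd p)))
      \<in> borel_measurable (N \<Otimes>\<^sub>M L2_borel)" if "k \<in> {1..K}" for k
    using that by (intro borel_measurable_mvn_density measurable_compose[OF measurable_fst \<mu>]
        measurable_compose[OF measurable_fst S] pd) (auto simp: space_pair_measure)
  then show ?thesis
    unfolding mixture_density_def case_prod_beta
    by (intro borel_measurable_sum borel_measurable_times measurable_compose[OF measurable_fst w]) auto
qed

text \<open>Split the event according to the finitely many values of \<open>\<sigma>\<close>. For
  each value, independence factors the probability, and a fixed permutation preserves the product
  measure; every piece thus contributes the same factor, with weights that sum to 1.\<close>

lemma (in prob_space) prob_permuted_sample:
  assumes P: "prob_space P" and f: "\<And>\<pi>. \<pi> \<in> F \<Longrightarrow> \<pi> permutes I"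
    and F: "finite F"
    and Y: "Y \<in> M \<rightarrow>\<^sub>M Pi\<^sub>M I (\<lambda>_. P)" "distr M (Pi\<^sub>M I (\<lambda>_. P)) Y = Pi\<^sub>M I (\<lambda>_. P)"
    and \<sigma>: "\<sigma> \<in> M \<rightarrow>\<^sub>M count_space F"
    and indep: "indep_set (sets (vimage_algebra (space M) \<sigma> (count_space F)))
      (sets (vimage_algebra (space M) Y (Pi\<^sub>M I (\<lambda>_. P))))"
    and A: "A \<in> sets (Pi\<^sub>M I (\<lambda>_. P))"
    and E_def: "E = {\<omega> \<in> space M. (\<lambda>i\<in>I. Y \<omega> (\<sigma> \<omega> i)) \<in> A}"
  shows "E \<in> events" and "prob E = measure (Pi\<^sub>M I (\<lambda>_. P)) A"
proof -
  define R where "R \<pi> = (\<lambda>z. \<lambda>i\<in>I. z (\<pi> i)) -` A \<inter> space (Pi\<^sub>M I (\<lambda>_. P))" for \<pi>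
  define U where "U \<pi> = (\<sigma> -` {\<pi>} \<inter> space M) \<inter> (Y -` R \<pi> \<inter> space M)" for \<pi>
  have perm: "(\<lambda>z. \<lambda>i\<in>I. z (\<pi> i)) \<in> Pi\<^sub>M I (\<lambda>_. P) \<rightarrow>\<^sub>M Pi\<^sub>M I (\<lambda>_. P)" if "\<pi> \<in> F" for \<pi>
    using permutes_in_image[OF f[OF that]]
    by (intro measurable_restrict measurable_component_singleton) auto
  have R: "R \<pi> \<in> sets (Pi\<^sub>M I (\<lambda>_. P))" if "\<pi> \<in> F" for \<pi>
    unfolding R_def by (rule measurable_sets[OF perm[OF that] A])
  have mR: "measure (Pi\<^sub>M I (\<lambda>_. P)) (R \<pi>) = measure (Pi\<^sub>M I (\<lambda>_. P)) A" if "\<pi> \<in> F" for \<pi>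
  proof -
    have "distr (Pi\<^sub>M I (\<lambda>_. P)) (Pi\<^sub>M I (\<lambda>_. P)) (\<lambda>z. \<lambda>i\<in>I. z (\<pi> i)) = Pi\<^sub>M I (\<lambda>_. P)"
      using P permutes_inj_on[OF f[OF that]] permutes_in_image[OF f[OF that]]
      by (intro distr_PiM_reindex) auto
    then show ?thesis
      unfolding R_def using measure_distr[OF perm[OF that] A] by simp
  qed
  have \<sigma>F: "\<sigma> \<omega> \<in> F" if "\<omega> \<in> space M" for \<omega>
    using measurable_space[OF \<sigma> that] by simp
  have E: "E = (\<Union>\<pi>\<in>F. U \<pi>)"
    using \<sigma>F measurable_space[OF Y(1)] by (auto simp: E_def U_def R_def)
  have \<sigma>ev: "\<sigma> -` {\<pi>} \<inter> space M \<in> events" if "\<pi> \<in> F" for \<pi>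
    using that by (intro measurable_sets[OF \<sigma>]) auto
  have U: "U \<pi> \<in> events" if "\<pi> \<in> F" for \<pi>
    unfolding U_def using \<sigma>ev[OF that] measurable_sets[OF Y(1) R[OF that]] by (rule sets.Int)
  show "E \<in> events" unfolding E using U F by auto
  have pU: "prob (U \<pi>) = prob (\<sigma> -` {\<pi>} \<inter> space M) * measure (Pi\<^sub>M I (\<lambda>_. P)) A"
    if "\<pi> \<in> F" for \<pi>
  proof -
    have "prob (U \<pi>) = prob (\<sigma> -` {\<pi>} \<inter> space M) * prob (Y -` R \<pi> \<inter> space M)"
      unfolding U_def using that R
      by (intro indep_setD[OF indep] in_vimage_algebra) auto
    also have "prob (Y -` R \<pi> \<inter> space M) = measure (Pi\<^sub>M I (\<lambda>_. P)) (R \<pi>)"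
      using measure_distr[OF Y(1) R[OF that]] Y(2) by simp
    finally show ?thesis using mR[OF that] by simp
  qed
  have "disjoint_family_on U F"
    by (auto simp: disjoint_family_on_def U_def)
  then have "prob E = (\<Sum>\<pi>\<in>F. prob (U \<pi>))"
    unfolding E using U F by (intro finite_measure_finite_Union) auto
  also have "\<dots> = (\<Sum>\<pi>\<in>F. prob (\<sigma> -` {\<pi>} \<inter> space M)) * measure (Pi\<^sub>M I (\<lambda>_. P)) A"
    using pU by (simp add: sum_distrib_right)
  also have "(\<Sum>\<pi>\<in>F. prob (\<sigma> -` {\<pi>} \<inter> space M)) = prob (\<Union>\<pi>\<in>F. \<sigma> -` {\<pi>} \<inter> space M)"
    using \<sigma>ev F by (intro finite_measure_finite_Union[symmetric]) (auto simp: disjoint_family_on_def)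
  also have "(\<Union>\<pi>\<in>F. \<sigma> -` {\<pi>} \<inter> space M) = space M"
    using \<sigma>F by auto
  finally show "prob E = measure (Pi\<^sub>M I (\<lambda>_. P)) A"
    by (simp add: prob_space)
qed

theorem proposition3p2:
  fixes M :: "'a measure" and P :: "(real \<Rightarrow> real) measure"
    and X :: "nat \<Rightarrow> 'a \<Rightarrow> real \<Rightarrow> real"
    and \<sigma> :: "'a \<Rightarrow> nat \<Rightarrow> nat"
    and \<phi> :: "(nat \<Rightarrow> real \<Rightarrow> real) \<Rightarrow> 'p::{finite,linorder} \<Rightarrow> real \<Rightarrow> real"
    and w :: "(nat \<Rightarrow> real \<Rightarrow> real) \<Rightarrow> nat \<Rightarrow> real"
    and \<mu> :: "(nat \<Rightarrow> real \<Rightarrow> real) \<Rightarrow> nat \<Rightarrow> real ^ 'p::{finite,linorder}"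
    and S :: "(nat \<Rightarrow> real \<Rightarrow> real) \<Rightarrow> nat \<Rightarrow> real ^ 'p::{finite,linorder} ^ 'p::{finite,linorder}"
    and \<alpha> :: real and n n1 K :: nat
  assumes "prob_space M"
    and "prob_space P" and "sets P = sets L2_borel"
    and "0 < \<alpha>" and "\<alpha> < 1" and "1 \<le> n1" and "n1 < n" and "1 \<le> K"
    and iid: "prob_space.indep_vars M (\<lambda>_. L2_borel) X {1..n + 1}"
      "\<And>i. i \<in> {1..n + 1} \<Longrightarrow> distr M L2_borel (X i) = P"
    and split: "\<sigma> \<in> M \<rightarrow>\<^sub>M count_space {\<pi>. \<pi> permutes {1..n}}"
      "prob_space.indep_set M
         (sets (vimage_algebra (space M) \<sigma> (count_space {\<pi>. \<pi> permutes {1..n}})))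
         (sets (vimage_algebra (space M) (\<lambda>\<omega>. \<lambda>i\<in>{1..n + 1}. X i \<omega>)
            (Pi\<^sub>M {1..n + 1} (\<lambda>_. L2_borel))))"
    and eigenfunctions:
      "\<And>x. x \<in> space (Pi\<^sub>M {1..n1} (\<lambda>_. L2_borel)) \<Longrightarrow>
         first_eigenfunctions (empirical_cov n1 x) (\<phi> x)"
      "\<And>j. (\<lambda>x. \<phi> x j) \<in> Pi\<^sub>M {1..n1} (\<lambda>_. L2_borel) \<rightarrow>\<^sub>M L2_borel"
    and proportions:
      "\<And>x k. x \<in> space (Pi\<^sub>M {1..n1} (\<lambda>_. L2_borel)) \<Longrightarrow> k \<in> {1..K} \<Longrightarrow> w x k > 0"
      "\<And>x. x \<in> space (Pi\<^sub>M {1..n1} (\<lambda>_. L2_borel)) \<Longrightarrow> (\<Sum>k=1..K. w x k) = 1"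
      "\<And>k. k \<in> {1..K} \<Longrightarrow> (\<lambda>x. w x k) \<in> borel_measurable (Pi\<^sub>M {1..n1} (\<lambda>_. L2_borel))"
    and means:
      "\<And>k. k \<in> {1..K} \<Longrightarrow> (\<lambda>x. \<mu> x k) \<in> borel_measurable (Pi\<^sub>M {1..n1} (\<lambda>_. L2_borel))"
    and covariances:
      "\<And>x k. x \<in> space (Pi\<^sub>M {1..n1} (\<lambda>_. L2_borel)) \<Longrightarrow> k \<in> {1..K} \<Longrightarrow> pos_definite (S x k)"
      "\<And>k. k \<in> {1..K} \<Longrightarrow> (\<lambda>x. S x k) \<in> borel_measurable (Pi\<^sub>M {1..n1} (\<lambda>_. L2_borel))"
  shows "(\<forall>\<omega>\<in>space M. union_of_bands K (refined_band \<alpha> n1 n K \<phi> w \<mu> S (relabel X \<sigma> \<omega>))) \<and>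
    inner_prob M {\<omega> \<in> space M. \<exists>k\<in>{1..K}. \<forall>t\<in>{0..1}.
        ereal (L2_proj (\<phi> (training n1 (relabel X \<sigma> \<omega>))) (X (n + 1) \<omega>) t)
          \<in> {band_lower \<alpha> n1 n K \<phi> w \<mu> S (relabel X \<sigma> \<omega>) k t ..
             band_upper \<alpha> n1 n K \<phi> w \<mu> S (relabel X \<sigma> \<omega>) k t}} \<ge> 1 - \<alpha>"
proof (rule conjI)
  show "\<forall>\<omega>\<in>space M. union_of_bands K (refined_band \<alpha> n1 n K \<phi> w \<mu> S (relabel X \<sigma> \<omega>))"
    unfolding union_of_bands_def refined_band_def by blast
next
  interpret prob_space M by fact
  let ?C = "{\<omega> \<in> space M. \<exists>k\<in>{1..K}. \<forall>t\<in>{0..1}.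
      ereal (L2_proj (\<phi> (training n1 (relabel X \<sigma> \<omega>))) (X (n + 1) \<omega>) t)
        \<in> {band_lower \<alpha> n1 n K \<phi> w \<mu> S (relabel X \<sigma> \<omega>) k t ..
           band_upper \<alpha> n1 n K \<phi> w \<mu> S (relabel X \<sigma> \<omega>) k t}}"
  define I where "I = {1..n + 1}"
  define J where "J = {n1 + 1..n + 1}"
  define F where "F = {\<pi>. \<pi> permutes {1..n}}"
  define Q where "Q = Pi\<^sub>M I (\<lambda>_. P)"
  define Y where "Y \<omega> = (\<lambda>i\<in>I. X i \<omega>)" for \<omega>
  define g where "g x f = mixture_density K (w x) (\<mu> x) (S x) (scores (\<phi> x) f)" for x f
  define m where "m = nat \<lceil>(real (n - n1) + 1) * \<alpha>\<rceil> - 1"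
  define A where "A = {z \<in> space Q. m \<le> card {i \<in> J - {n + 1}.
      g (restrict z (I - J)) (z i) \<le> g (restrict z (I - J)) (z (n + 1))}}"
  \<comment> \<open>The witness for the inner probability: the rank event of the relabelled sample,
    which is measurable and will be shown to lie in \<open>?C\<close>.\<close>
  define E where "E = {\<omega> \<in> space M. (\<lambda>i\<in>I. Y \<omega> (\<sigma> \<omega> i)) \<in> A}"
  have IJ: "finite I" "J \<subseteq> I" "n + 1 \<in> J" "I - J = {1..n1}" "J - {n + 1} = {n1 + 1..n}"
    "card J = n - n1 + 1"
    using \<open>n1 < n\<close> by (auto simp: I_def J_def)
  \<comment> \<open>The hypotheses speak of \<open>L2_borel\<close>, while the product measure has
    to be built from \<open>P\<close>. Both have the same measurable sets, and this equation
    transfers between them.\<close>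
  have sets_PiM_P: "sets (Pi\<^sub>M L (\<lambda>_. P)) = sets (Pi\<^sub>M L (\<lambda>_. L2_borel))" for L :: "nat set"
    by (intro sets_PiM_cong) (auto simp: assms)
  have "(\<lambda>(x, f). g x f) \<in> borel_measurable (Pi\<^sub>M {1..n1} (\<lambda>_. L2_borel) \<Otimes>\<^sub>M L2_borel)"
    unfolding g_def by (rule measurable_mixture_score) (use assms in auto)
  also have "borel_measurable (Pi\<^sub>M {1..n1} (\<lambda>_. L2_borel) \<Otimes>\<^sub>M L2_borel)
      = borel_measurable (Pi\<^sub>M (I - J) (\<lambda>_. P) \<Otimes>\<^sub>M P)"
    using IJ(4) sets_PiM_P \<open>sets P = sets L2_borel\<close>
    by (intro measurable_cong_sets sets_pair_measure_cong) auto
  finally have g: "(\<lambda>(x, f). g x f) \<in> borel_measurable (Pi\<^sub>M (I - J) (\<lambda>_. P) \<Otimes>\<^sub>M P)" .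
  have A: "A \<in> sets Q"
    and cov: "real (card J) - real m \<le> real (card J) * measure Q A"
    unfolding A_def Q_def by (fact conformal_coverage[OF \<open>prob_space P\<close> IJ(1-3) g, of m])+
  have "0 \<le> (real (n - n1) + 1) * \<alpha>"
    using \<open>0 < \<alpha>\<close> by simp
  \<comment> \<open>Subtracting 1 more than undoes the rounding up. The factor n - n1 + 1 is
    \<open>card J\<close>, the new curve being counted with the calibration curves.\<close>
  then have "real m \<le> (real (n - n1) + 1) * \<alpha>"
    unfolding m_def by linarith
  then have "real m \<le> real (card J) * \<alpha>"
    by (simp add: IJ(6) algebra_simps)
  with cov have "real (card J) * (1 - \<alpha>) \<le> real (card J) * measure Q A"
    by (simp add: algebra_simps)
  then have QA: "1 - \<alpha> \<le> measure Q A"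
    using IJ(6) by simp
  have X: "X i \<in> M \<rightarrow>\<^sub>M L2_borel" if "i \<in> I" for i
    using iid(1) that by (simp add: indep_vars_def I_def)
  have Y: "Y \<in> M \<rightarrow>\<^sub>M Q"
    unfolding Y_def Q_def measurable_cong_sets[OF refl sets_PiM_P]
    by (intro measurable_restrict X)
  have "distr M (Pi\<^sub>M I (\<lambda>_. L2_borel)) Y = Pi\<^sub>M I (\<lambda>i. distr M L2_borel (X i))"
    unfolding Y_def[abs_def] using iid(1) X
    by (subst indep_vars_iff_distr_eq_PiM'[symmetric]) (auto simp: I_def)
  also have "\<dots> = Q"
    unfolding Q_def using iid(2) by (intro PiM_cong) (auto simp: I_def)
  also have "distr M (Pi\<^sub>M I (\<lambda>_. L2_borel)) Y = distr M Q Y"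
    unfolding Q_def using sets_PiM_P by (intro distr_cong) auto
  finally have dist: "distr M Q Y = Q" .
  \<comment> \<open>A relabelling of the sample fixes n + 1, so it extends to all of
    \<open>I\<close> and leaves the new curve in place.\<close>
  have perm: "\<pi> permutes I" if "\<pi> \<in> F" for \<pi>
    using that permutes_subset[of \<pi> "{1..n}" I] by (auto simp: F_def I_def)
  have "finite F" by (simp add: F_def finite_permutations)
  have \<sigma>: "\<sigma> \<in> M \<rightarrow>\<^sub>M count_space F"
    using split(1) by (simp add: F_def)
  have "vimage_algebra (space M) Y (Pi\<^sub>M I (\<lambda>_. L2_borel)) = vimage_algebra (space M) Y Q"
    unfolding Q_def using sets_PiM_P by (intro vimage_algebra_cong) auto
  then have indep: "indep_set (sets (vimage_algebra (space M) \<sigma> (count_space F)))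
      (sets (vimage_algebra (space M) Y Q))"
    using split(2) by (simp add: F_def Y_def[abs_def] I_def)
  have E: "E \<in> events" "prob E = measure Q A"
    using prob_permuted_sample[OF \<open>prob_space P\<close> perm \<open>finite F\<close> Y[unfolded Q_def]
        dist[unfolded Q_def] \<sigma> indep[unfolded Q_def] A[unfolded Q_def] E_def]
    by (simp_all add: Q_def)
  have "E \<subseteq> ?C"
  proof
    fix \<omega> assume "\<omega> \<in> E"
    define z where "z = relabel X \<sigma> \<omega>"
    \<comment> \<open>\<open>Z\<close> is the relabelled sample as a point of the product space,
      hence undefined outside \<open>I\<close>; \<open>z\<close> is the unrestricted function used
      by the band. They agree on \<open>I\<close>.\<close>
    define Z where "Z = (\<lambda>i\<in>I. Y \<omega> (\<sigma> \<omega> i))"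
    define x where "x = training n1 z"
    have \<omega>: "\<omega> \<in> space M" and Z: "Z \<in> A"
      using \<open>\<omega> \<in> E\<close> by (auto simp: E_def Z_def)
    have \<pi>: "\<sigma> \<omega> permutes {1..n}"
      using measurable_space[OF \<sigma> \<omega>] by (simp add: F_def)
    then have "\<sigma> \<omega> i \<in> I" if "i \<in> I" for i
      using that perm[of "\<sigma> \<omega>"] by (simp add: F_def permutes_in_image)
    then have Zz: "Z i = z i" if "i \<in> I" for i
      using that by (simp add: Z_def Y_def z_def relabel_def)
    have zn: "z (n + 1) = X (n + 1) \<omega>"
      using \<pi> by (simp add: z_def relabel_def permutes_not_in)
    have Zx: "restrict Z (I - J) = x"
      unfolding x_def training_def IJ(4) by (rule restrict_ext) (use \<open>n1 < n\<close> in \<open>auto simp: Zz I_def\<close>)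
    \<comment> \<open>Positivity of the proportions and definiteness of the covariances are assumed
      only at points of the training space.\<close>
    have "x \<in> space (Pi\<^sub>M (I - J) (\<lambda>_. P))"
      using Z Zx unfolding A_def Q_def
      by (auto simp: space_PiM PiE_def)
    then have x: "x \<in> space (Pi\<^sub>M {1..n1} (\<lambda>_. L2_borel))"
      using sets_eq_imp_space_eq[OF sets_PiM_P] by (simp add: IJ(4))
    have "m \<le> card {i \<in> {n1 + 1..n}. g x (Z i) \<le> g x (Z (n + 1))}"
      using Z unfolding A_def IJ(5) mem_Collect_eq Zx by (rule conjunct2)
    also have "{i \<in> {n1 + 1..n}. g x (Z i) \<le> g x (Z (n + 1))}
        = {i \<in> {n1 + 1..n}. g x (z i) \<le> g x (z (n + 1))}"
      by (auto simp: Zz I_def)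
    finally have "threshold \<alpha> n1 n K \<phi> w \<mu> S z \<le> ereal (g x (X (n + 1) \<omega>))"
      using \<open>\<alpha> < 1\<close> \<open>n1 < n\<close> unfolding m_def g_def x_def zn
      by (simp add: threshold_le_iff)
    then obtain k where "k \<in> {1..K}" "\<And>t. ereal (L2_proj (\<phi> x) (X (n + 1) \<omega>) t)
        \<in> {band_lower \<alpha> n1 n K \<phi> w \<mu> S z k t .. band_upper \<alpha> n1 n K \<phi> w \<mu> S z k t}"
      using covered_if_threshold_le[of K S n1 z w \<alpha> n \<phi> \<mu> "X (n + 1) \<omega>"]
        \<open>1 \<le> K\<close> covariances(1)[OF x] proportions(1)[OF x]
      unfolding x_def g_def by metis
    then show "\<omega> \<in> ?C"
      using \<omega> unfolding x_def z_def by blast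
  qed
  then have "prob E \<le> inner_prob M ?C"
    unfolding inner_prob_def using E(1)
    by (intro cSUP_upper) (auto intro!: bdd_aboveI[of _ 1])
  then show "1 - \<alpha> \<le> inner_prob M ?C"
    using QA E(2) by linarith
qed

end
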